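(* Let $p,b$ and $c$ be positive real constants. Then for every $t>0$ $$\left(p-\frac bc\right)\int_0^t\frac{e^{ps}}{(s+c)^b}\,ds<\frac{e^{pt}}{(c+t)^b}.$$ *)

theory Defs
  imports "HOL-Analysis.Analysis"
begin

end

theory Submission
  imports Defs
begin

text \<open>The function \<open>F s = exp (p * s) / (s + c) powr b\<close> satisfies
  \<open>F' s = (p - b / (s + c)) * F s \<ge> (p - b / c) * F s\<close> for \<open>s \<ge> 0\<close>; integrating over
  \<open>[0, t]\<close> and dropping \<open>F 0 > 0\<close> gives the strict bound.\<close>

theorem lemma2p10:
  fixes p b c t :: real
  assumes "p > 0" and "b > 0" and "c > 0" and "t > 0"
  shows "(p - b / c) * integral {0..t} (\<lambda>s. exp (p * s) / (s + c) powr b)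
           < exp (p * t) / (c + t) powr b"
proof -
  define F where "F = (\<lambda>s. exp (p * s) / (s + c) powr b)"
  have deriv: "(F has_real_derivative (p - b / (s + c)) * F s) (at s within {0..t})"
    if "s \<in> {0..t}" for s
  proof -
    have pos: "s + c > 0" using that assms by simp
    \<comment> \<open>With the quotient as a product, the product rule applies; since
      \<open>s + c > 0\<close>, the term \<open>(s + c) powr (- b - 1)\<close> equals
      \<open>(s + c) powr (- b) / (s + c)\<close>, so the original product factors out.\<close>
    have "((\<lambda>s. exp (p * s) * (s + c) powr (- b)) has_real_derivative
        (p - b / (s + c)) * (exp (p * s) * (s + c) powr (- b))) (at s within {0..t})"
      using pos by (auto intro!: derivative_eq_intros simp: powr_diff field_simps)
    then show ?thesis by (simp add: F_def powr_minus_divide)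
  qed
  have "continuous_on {0..t} F"
    using deriv by (rule DERIV_continuous_on)
  then have "(F has_integral integral {0..t} F) {0..t}"
    by (intro integrable_integral integrable_continuous_real)
  then have "((\<lambda>s. (p - b / c) * F s) has_integral (p - b / c) * integral {0..t} F) {0..t}"
    by (rule has_integral_mult_right)
  moreover have "((\<lambda>s. (p - b / (s + c)) * F s) has_integral F t - F 0) {0..t}"
    using assms deriv
    by (intro fundamental_theorem_of_calculus)
       (auto simp: has_real_derivative_iff_has_vector_derivative)
  \<comment> \<open>Here \<open>c \<le> s + c\<close> gives \<open>b / (s + c) \<le> b / c\<close>,
    and the factor \<open>F s \<ge> 0\<close> keeps the direction whatever the sign of
    \<open>p - b / c\<close>.\<close>
  moreover have "(p - b / c) * F s \<le> (p - b / (s + c)) * F s" if "s \<in> {0..t}" for s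
    using that assms by (intro mult_right_mono diff_left_mono divide_left_mono) (auto simp: F_def)
  ultimately have "(p - b / c) * integral {0..t} F \<le> F t - F 0"
    by (rule has_integral_le)
  moreover have "F 0 > 0" using assms by (simp add: F_def)
  ultimately have "(p - b / c) * integral {0..t} F < F t" by linarith
  then show ?thesis by (simp add: F_def add.commute)
qed

end
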